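(* Let $(A,m_* )$ be a simple $A_\infty$-algebra with Poincaré duality of dimension $N$, choose a fundamental class, i.e. an isomorphism $A^N\cong\mathbb{Q}$ with associated homomorphism $\int\colon A^N\to\mathbb{Q}$ (extended by $0$ to other degrees), and let $\Phi\colon A^k\to(A^{N-k})^\vee$ be the isomorphism defined by $(\Phi(a))(b)=\int m_2(a,b)$. Then for any $l\le k$ (with $l\geq 1$) and homogeneous $x_1,\dots,x_k,b\in A$, $$\bigl(\Phi(m_k(x_1,\dots,x_k))\bigr)(b)=(-1)^{kl+\Sigma_1^{l-1}\left(\Sigma_{l+1}^k+|b|+|x_l|\right)+k|x_l|}\,\Phi(x_l)\bigl(m_k(x_{l+1},\dots,x_k,b,x_1,\dots,x_{l-1})\bigr),$$ where $\Sigma_i^j:=\sum_{t=i}^j|x_t|$.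
   Context: $A_\infty$-algebras are over $\mathbb{Q}$, $\mathbb{Z}$-graded, with operations $m_k\colon A^{\otimes k}\to A$ of degree $2-k$ satisfying $\sum_{r+s+t=n}(-1)^{r+st}m_{r+1+t}(1^{\otimes r}\otimes m_s\otimes1^{\otimes t})=0$ for all $n\geq 1$, with the Koszul sign rule when evaluating on elements. Minimal means $m_1=0$. A minimal $A_\infty$-algebra with (graded-)commutative $m_2$ satisfies Poincaré duality with dimension $N$ if $A^N\cong\mathbb{Q}$ and the pairings $m_2\colon A^k\otimes A^{N-k}\to A^N\cong\mathbb{Q}$ are non-degenerate, so that the induced maps $A^k\to(A^{N-k})^\vee$ are isomorphisms. Simple: a minimal $A_\infty$-algebra $(A,m_* )$ with commutative $m_2$ satisfying Poincaré duality with dimension $N$ is simple if $m_k$ maps trivially to $A^N$ for all $k\ge3$ (i.e. the component of $m_k$ with values in $A^N$ is zero). *)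

theory Defs
  imports Complex_Main
begin

text \<open>
  A \<open>\<int>\<close>-graded rational vector space is given as an ambient space with scalar
  multiplication \<^term>\<open>scale\<close>, which is the internal direct sum of the
  subspaces \<open>A n\<close>.
\<close>

definition homogeneous_decomposition ::
    "(int \<Rightarrow> 'a::ab_group_add set) \<Rightarrow> 'a \<Rightarrow> (int \<Rightarrow> 'a) \<Rightarrow> bool" where
  "homogeneous_decomposition A x c \<longleftrightarrow>
     (\<forall>n. c n \<in> A n) \<and> finite {n. c n \<noteq> 0} \<and> x = (\<Sum>n | c n \<noteq> 0. c n)"

definition homogeneous_component ::
    "(int \<Rightarrow> 'a::ab_group_add set) \<Rightarrow> int \<Rightarrow> 'a \<Rightarrow> 'a" where
  "homogeneous_component A n x = (THE c. homogeneous_decomposition A x c) n"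

locale graded_rat_vector_space = vector_space scale
  for scale :: "rat \<Rightarrow> 'a::ab_group_add \<Rightarrow> 'a" +
  fixes A :: "int \<Rightarrow> 'a set"
  assumes subspace_degree: "subspace (A n)"
    and direct_sum: "\<exists>!c. homogeneous_decomposition A x c"

text \<open>
  The tuple \<open>xs\<close> is homogeneous with degrees \<open>ds\<close>.  The degrees are
  recorded separately because \<open>0\<close> is homogeneous of every degree.
\<close>

definition homogeneous :: "(int \<Rightarrow> 'a set) \<Rightarrow> int list \<Rightarrow> 'a list \<Rightarrow> bool" where
  "homogeneous A ds xs \<longleftrightarrow> list_all2 (\<lambda>d x. x \<in> A d) ds xs"

text \<open>
  A linear map on the \<open>k\<close>-fold tensor power is encoded as a multilinear map
  \<open>m k\<close> on lists of length \<open>k\<close>; values on lists of other lengths, and \<open>m 0\<close>,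
  are irrelevant.  The relations are identities of maps on the \<open>n\<close>-fold tensor
  power, evaluated here on homogeneous elements, which generate it: moving \<open>m s\<close>
  (of degree \<open>2 - s\<close>) past the first \<open>r\<close> arguments contributes the Koszul sign
  \<open>(-1) powi ((2 - int s) * sum_list (take r ds))\<close>.
\<close>

locale A_infinity_algebra = graded_rat_vector_space scale A
  for scale :: "rat \<Rightarrow> 'a::ab_group_add \<Rightarrow> 'a" and A :: "int \<Rightarrow> 'a set" +
  fixes m :: "nat \<Rightarrow> 'a list \<Rightarrow> 'a"
  assumes multilinear:
      "length xs + 1 + length ys = k \<Longrightarrow>
         Vector_Spaces.linear scale scale (\<lambda>x. m k (xs @ x # ys))"
    and degree:
      "1 \<le> k \<Longrightarrow> length xs = k \<Longrightarrow> homogeneous A ds xs \<Longrightarrow>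
         m k xs \<in> A (sum_list ds + 2 - int k)"
    and A_infinity_relation:
      "1 \<le> n \<Longrightarrow> length xs = n \<Longrightarrow> homogeneous A ds xs \<Longrightarrow>
         (\<Sum>(r, s, t) \<in> {(r, s, t). r + s + t = n \<and> 1 \<le> s}.
            scale ((-1) ^ (r + s * t) * (-1) powi ((2 - int s) * sum_list (take r ds)))
              (m (r + 1 + t) (take r xs @ m s (take s (drop r xs)) # drop (r + s) xs))) = 0"

locale minimal_commutative_A_infinity_algebra = A_infinity_algebra scale A m
  for scale :: "rat \<Rightarrow> 'a::ab_group_add \<Rightarrow> 'a" and A :: "int \<Rightarrow> 'a set"
    and m :: "nat \<Rightarrow> 'a list \<Rightarrow> 'a" +
  assumes minimal: "m 1 [x] = 0"
    and graded_commutative: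
      "x \<in> A p \<Longrightarrow> y \<in> A q \<Longrightarrow> m 2 [x, y] = scale ((-1) powi (p * q)) (m 2 [y, x])"

text \<open>
  The dual of \<open>A n\<close>: a functional on \<open>A n\<close> is identified with its extension by
  \<open>0\<close> to the other degrees, that is, with a functional on the whole space that
  vanishes on \<open>A j\<close> for all \<open>j \<noteq> n\<close>.
\<close>

definition graded_dual ::
    "(rat \<Rightarrow> 'a::ab_group_add \<Rightarrow> 'a) \<Rightarrow> (int \<Rightarrow> 'a set) \<Rightarrow> int \<Rightarrow> ('a \<Rightarrow> rat) set" where
  "graded_dual scale A n =
     {f. Vector_Spaces.linear scale (*) f \<and> (\<forall>j. j \<noteq> n \<longrightarrow> (\<forall>x \<in> A j. f x = 0))}"

definition fundamental_class ::
    "(rat \<Rightarrow> 'a::ab_group_add \<Rightarrow> 'a) \<Rightarrow> (int \<Rightarrow> 'a set) \<Rightarrow> int \<Rightarrow> ('a \<Rightarrow> rat) \<Rightarrow> bool" where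
  "fundamental_class scale A N I \<longleftrightarrow>
     I \<in> graded_dual scale A N \<and> bij_betw I (A N) UNIV"

definition duality_map :: "(nat \<Rightarrow> 'a list \<Rightarrow> 'a) \<Rightarrow> ('a \<Rightarrow> rat) \<Rightarrow> 'a \<Rightarrow> 'a \<Rightarrow> rat" where
  "duality_map m I a = (\<lambda>b. I (m 2 [a, b]))"

text \<open>
  Non-degeneracy of the pairings is expressed by the induced maps
  \<open>A k \<rightarrow> (A (N - k))\<^sup>\<or>\<close> being isomorphisms; their linearity is automatic.
  Since two fundamental classes differ by a nonzero scalar, the condition does not
  depend on the choice of \<open>I\<close>.
\<close>

locale Poincare_duality_A_infinity_algebra =
  minimal_commutative_A_infinity_algebra scale A m
  for scale :: "rat \<Rightarrow> 'a::ab_group_add \<Rightarrow> 'a" and A :: "int \<Rightarrow> 'a set"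
    and m :: "nat \<Rightarrow> 'a list \<Rightarrow> 'a" +
  fixes N :: int
  assumes Poincare_duality:
    "\<exists>I. fundamental_class scale A N I \<and>
         (\<forall>k. bij_betw (duality_map m I) (A k) (graded_dual scale A (N - k)))"

locale simple_A_infinity_algebra = Poincare_duality_A_infinity_algebra scale A m N
  for scale :: "rat \<Rightarrow> 'a::ab_group_add \<Rightarrow> 'a" and A :: "int \<Rightarrow> 'a set"
    and m :: "nat \<Rightarrow> 'a list \<Rightarrow> 'a" and N :: int +
  assumes simple: "3 \<le> k \<Longrightarrow> length xs = k \<Longrightarrow> homogeneous_component A N (m k xs) = 0"

end

theory Submission
  imports Defs
begin

text \<open>
  Evaluate the \<open>A\<^sub>\<infinity>\<close>-relation on \<open>k + 1\<close> homogeneous elements and apply the fundamental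
  class.  Simplicity kills all terms whose outer operation is \<open>m\<^sub>j\<close> with \<open>j \<ge> 3\<close>, and
  minimality those with \<open>j = 1\<close>; the two remaining terms, with outer operation \<open>m\<^sub>2\<close>, give the
  case \<open>l = 1\<close>.  Moving \<open>x\<^sub>1\<close> to the other side of \<open>m\<^sub>2\<close> by graded commutativity makes it play
  the role of \<open>b\<close>, so the case \<open>l = 1\<close> can be iterated.
\<close>

lemma minus_one_powi_cong_parity:
  fixes a b :: int
  assumes "even (a - b)"
  shows "(-1) powi a = ((-1) powi b :: 'a::division_ring)"
  using assms by (simp add: power_int_minus_left)

lemma minus_one_powi_add:
  "(-1) powi (a + b) = ((-1) powi a * (-1) powi b :: 'a::field)"
  by (simp add: power_int_add)

lemma fundamental_class_linear:
  assumes "fundamental_class scale A N I"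
  shows "Vector_Spaces.linear scale (*) I"
  using assms by (simp add: fundamental_class_def graded_dual_def)

context graded_rat_vector_space
begin

lemma homogeneous_decomposition_component:
  "homogeneous_decomposition A x (\<lambda>n. homogeneous_component A n x)"
  using theI'[OF direct_sum] by (simp add: homogeneous_component_def)

text \<open>By linearity, \<open>f x\<close> is the sum of the values of \<open>f\<close> on the
  homogeneous components of \<open>x\<close>, and \<open>f\<close> kills those of degree other than
  \<open>n\<close>. This turns \<open>simple\<close>, a condition on components, into the vanishing
  of \<open>I\<close>.\<close>

lemma graded_dual_eq_0:
  assumes "f \<in> graded_dual scale A n" and "homogeneous_component A n x = 0"
  shows "f x = 0"
proof -
  let ?c = "\<lambda>i. homogeneous_component A i x"
  interpret f: Vector_Spaces.linear scale "(*)" f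
    using assms(1) by (simp add: graded_dual_def)
  have c: "?c i \<in> A i" for i
    using homogeneous_decomposition_component[of x]
    by (simp add: homogeneous_decomposition_def)
  have x: "x = (\<Sum>i | ?c i \<noteq> 0. ?c i)"
    using homogeneous_decomposition_component[of x]
    by (simp add: homogeneous_decomposition_def)
  have "f x = (\<Sum>i | ?c i \<noteq> 0. f (?c i))"
    by (subst x) (rule f.sum)
  also have "\<dots> = 0"
  proof (intro sum.neutral ballI)
    fix i assume "i \<in> {i. ?c i \<noteq> 0}"
    with assms(2) have "i \<noteq> n" by auto
    with assms(1) c show "f (?c i) = 0" by (auto simp: graded_dual_def)
  qed
  finally show ?thesis .
qed

end

context simple_A_infinity_algebra
begin

lemma fundamental_class_outer_eq_0:
  assumes I: "fundamental_class scale A N I" and "length ys = j" "1 \<le> j" "j \<noteq> 2"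
  shows "I (m j ys) = 0"
proof (cases "j = 1")
  case True
  then obtain y where "ys = [y]"
    using assms(2) by (metis One_nat_def length_0_conv length_Suc_conv)
  interpret I: Vector_Spaces.linear scale "(*)" I
    using I by (rule fundamental_class_linear)
  show ?thesis using True \<open>ys = [y]\<close> minimal I.zero by simp
next
  case False
  with assms have "homogeneous_component A N (m j ys) = 0"
    by (intro simple) auto
  with I show ?thesis
    unfolding fundamental_class_def by (auto intro: graded_dual_eq_0)
qed

lemma fundamental_class_rotate_first:
  assumes I: "fundamental_class scale A N I"
    and y: "y \<in> A p" and ys: "homogeneous A ps ys" and c: "c \<in> A q"
    and k: "k = Suc (length ys)"
  shows "I (m 2 [m k (y # ys), c])
    = (-1) powi (int k + int k * p) * I (m 2 [y, m k (ys @ [c])])"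
proof -
  interpret I: Vector_Spaces.linear scale "(*)" I
    using I by (rule fundamental_class_linear)
  define xs where "xs = y # ys @ [c]"
  define ds where "ds = p # ps @ [q]"
  define S where "S = {(r, s, t). r + s + t = k + 1 \<and> 1 \<le> s}"
  define F where "F = (\<lambda>(r, s, t).
      ((-1) ^ (r + s * t) * (-1) powi ((2 - int s) * sum_list (take r ds)))
      * I (m (r + 1 + t) (take r xs @ m s (take s (drop r xs)) # drop (r + s) xs)))"
  have len: "length xs = k + 1" by (simp add: xs_def k)
  have "homogeneous A ds xs"
    using y ys c by (simp add: homogeneous_def xs_def ds_def list_all2_appendI)
  from A_infinity_relation[OF _ len this]
  have "I (\<Sum>(r, s, t) \<in> S.
            scale ((-1) ^ (r + s * t) * (-1) powi ((2 - int s) * sum_list (take r ds)))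
              (m (r + 1 + t) (take r xs @ m s (take s (drop r xs)) # drop (r + s) xs))) = 0"
    by (simp add: S_def I.zero)
  then have "sum F S = 0"
    by (simp add: I.sum I.scale F_def case_prod_unfold)
  \<comment> \<open>The outer operation has arity \<open>r + 1 + t\<close>. Since
    \<open>r + s + t = k + 1\<close>, this equals 2 only when \<open>s = k\<close>, leaving one free
    slot either after or before the inner operation.\<close>
  moreover have "sum F S = sum F {(0, k, 1), (1, k, 0)}"
  proof (rule sum.mono_neutral_right)
    have "S \<subseteq> {..k + 1} \<times> {..k + 1} \<times> {..k + 1}" by (auto simp: S_def)
    then show "finite S" by (rule finite_subset) simp
    show "{(0, k, 1), (1, k, 0)} \<subseteq> S" by (auto simp: S_def k)
    show "\<forall>u \<in> S - {(0, k, 1), (1, k, 0)}. F u = 0"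
    proof
      fix u assume u: "u \<in> S - {(0, k, 1), (1, k, 0)}"
      obtain r s t where rst: "u = (r, s, t)" by (cases u)
      with u have "r + s + t = k + 1" "1 \<le> s" "r + 1 + t \<noteq> 2"
        by (auto simp: S_def)
      then show "F u = 0"
        using len by (simp add: F_def rst fundamental_class_outer_eq_0[OF I])
    qed
  qed
  ultimately have "F (0, k, 1) + F (1, k, 0) = 0" by simp
  moreover have "F (0, k, 1) = (-1) ^ k * I (m 2 [m k (y # ys), c])"
    by (simp add: F_def xs_def k numeral_2_eq_2)
  \<comment> \<open>The minus sign is \<open>(-1) ^ r\<close> with \<open>r = 1\<close>; the power
    of -1 is the Koszul sign for moving \<open>m k\<close> past \<open>y\<close>.\<close>
  moreover have "F (1, k, 0) = - ((-1) powi ((2 - int k) * p) * I (m 2 [y, m k (ys @ [c])]))"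
    by (simp add: F_def xs_def ds_def k numeral_2_eq_2)
  ultimately have "(-1) powi int k * I (m 2 [m k (y # ys), c])
      = (-1) powi ((2 - int k) * p) * I (m 2 [y, m k (ys @ [c])])"
    by simp
  \<comment> \<open>The sign on the left is its own inverse, so multiplying by it once more isolates
    the left pairing.\<close>
  then have "(-1) powi int k * ((-1) powi int k * I (m 2 [m k (y # ys), c]))
      = (-1) powi (int k + (2 - int k) * p) * I (m 2 [y, m k (ys @ [c])])"
    by (simp only: minus_one_powi_add mult.assoc)
  moreover have "(-1) powi (int k + (2 - int k) * p) = ((-1) powi (int k + int k * p) :: rat)"
    by (rule minus_one_powi_cong_parity) (simp add: algebra_simps)
  moreover have "(-1) powi int k * ((-1) powi int k * z) = z" for z :: rat
    by (simp add: power_int_minus_left)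
  ultimately show ?thesis by simp
qed

text \<open>Here \<open>us\<close> holds the arguments before the pivot \<open>y\<close>. The
  induction removes the last entry \<open>z\<close> of \<open>us\<close>, the neighbour of
  \<open>y\<close>, and applies the hypothesis with pivot \<open>z\<close> and suffix
  \<open>y # vs\<close>; hence the pivot and the suffix must be generalised.\<close>

lemma fundamental_class_rotate:
  assumes I: "fundamental_class scale A N I"
    and "homogeneous A ps us" "y \<in> A p" "homogeneous A qs vs" "b \<in> A e"
    and "k = length us + 1 + length vs"
  shows "I (m 2 [m k (us @ y # vs), b])
    = (-1) powi (int k * (int (length us) + 1)
        + sum_list ps * (sum_list qs + e + p) + int k * p)
      * I (m 2 [y, m k (vs @ b # us)])"
  using assms(2-)
proof (induction us arbitrary: ps y p vs qs rule: rev_induct)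
  case Nil
  then have "ps = []" by (simp add: homogeneous_def)
  with fundamental_class_rotate_first[OF I Nil(2,3,4), of k] Nil show ?case
    by (simp add: algebra_simps)
next
  case (snoc z us)
  let ?k = "int k" and ?zs = "vs @ b # us"
  from snoc.prems(1) obtain ps' r
    where ps: "ps = ps' @ [r]" and us: "homogeneous A ps' us" and z: "z \<in> A r"
    by (auto simp: homogeneous_def list_all2_append2 list_all2_Cons2)
  have yvs: "homogeneous A (p # qs) (y # vs)" and zs: "homogeneous A (qs @ e # ps') ?zs"
    using snoc.prems us by (auto simp: homogeneous_def intro!: list_all2_appendI)
  \<comment> \<open>\<open>E\<close> is the exponent supplied by the induction hypothesis.
    \<open>C\<close> is the exponent from graded commutativity: \<open>r\<close> times the degree of
    \<open>m k (y # ?zs)\<close>.\<close>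
  define E where "E = ?k * (int (length us) + 1)
        + sum_list ps' * (p + sum_list qs + e + r) + ?k * r"
  define C where "C = r * (p + sum_list qs + e + sum_list ps' + 2 - ?k)"
  have "m k (y # ?zs) \<in> A (sum_list (p # qs @ e # ps') + 2 - ?k)"
    using zs snoc.prems by (intro degree) (auto simp: homogeneous_def)
  with z have comm: "m 2 [z, m k (y # ?zs)] = scale ((-1) powi C) (m 2 [m k (y # ?zs), z])"
    by (subst graded_commutative[OF z]) (auto simp: C_def add.assoc)
  interpret I: Vector_Spaces.linear scale "(*)" I
    using I by (rule fundamental_class_linear)
  have "I (m 2 [m k ((us @ [z]) @ y # vs), b])
      = (-1) powi E * I (m 2 [z, m k (y # ?zs)])"
    using snoc.IH[OF us z yvs snoc.prems(4)] snoc.prems(5) by (simp add: E_def)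
  also have "\<dots> = (-1) powi E * ((-1) powi C * I (m 2 [m k (y # ?zs), z]))"
    by (simp only: comm I.scale)
  \<comment> \<open>With \<open>z\<close> now on the right, the case of an empty prefix takes
    \<open>y\<close> out in front and appends \<open>z\<close> behind \<open>us\<close>, which
    restores the prefix \<open>us @ [z]\<close>.\<close>
  also have "I (m 2 [m k (y # ?zs), z])
      = (-1) powi (?k + ?k * p) * I (m 2 [y, m k (?zs @ [z])])"
    using snoc.prems(5) by (intro fundamental_class_rotate_first[OF I snoc.prems(2) zs z]) simp
  also have "(-1) powi E * ((-1) powi C * ((-1) powi (?k + ?k * p) * I (m 2 [y, m k (?zs @ [z])])))
      = (-1) powi (E + C + (?k + ?k * p)) * I (m 2 [y, m k (?zs @ [z])])"
    by (simp only: minus_one_powi_add mult.assoc)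
  also have "(-1) powi (E + C + (?k + ?k * p)) = ((-1) powi (?k * (int (length (us @ [z])) + 1)
        + sum_list ps * (sum_list qs + e + p) + ?k * p) :: rat)"
  proof (rule minus_one_powi_cong_parity)
    \<comment> \<open>The terms \<open>?k * r\<close> of \<open>E\<close> and
      \<open>- ?k * r\<close> of \<open>C\<close> cancel. What remains is
      \<open>r * sum_list ps'\<close>, once from each of \<open>E\<close> and \<open>C\<close>, and
      \<open>2 * r\<close> from the degree shift of \<open>m k\<close>.\<close>
    have "E + C + (?k + ?k * p) - (?k * (int (length (us @ [z])) + 1)
        + sum_list ps * (sum_list qs + e + p) + ?k * p) = 2 * (r * (sum_list ps' + 1))"
      by (simp add: E_def C_def ps algebra_simps)
    then show "even (E + C + (?k + ?k * p) - (?k * (int (length (us @ [z])) + 1)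
        + sum_list ps * (sum_list qs + e + p) + ?k * p))" by simp
  qed
  finally show ?case by simp
qed

end

theorem proposition8p3:
  fixes scale :: "rat \<Rightarrow> 'a::ab_group_add \<Rightarrow> 'a"
    and A :: "int \<Rightarrow> 'a set"
    and m :: "nat \<Rightarrow> 'a list \<Rightarrow> 'a"
    and N :: int
    and I :: "'a \<Rightarrow> rat"
    and k l :: nat
    and x :: "nat \<Rightarrow> 'a" and d :: "nat \<Rightarrow> int"
    and b :: 'a and e :: int
  assumes "simple_A_infinity_algebra scale A m N"
    and "fundamental_class scale A N I"
    and "1 \<le> l" and "l \<le> k"
    and "\<And>i. i \<in> {1..k} \<Longrightarrow> x i \<in> A (d i)"
    and "b \<in> A e"
  shows "duality_map m I (m k (map x [1..<k + 1])) b =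
    (-1) powi (int k * int l
        + (\<Sum>t = 1..l - 1. d t) * ((\<Sum>t = l + 1..k. d t) + e + d l)
        + int k * d l)
    * duality_map m I (x l) (m k (map x [l + 1..<k + 1] @ [b] @ map x [1..<l]))"
proof -
  interpret simple_A_infinity_algebra scale A m N by fact
  have hom: "homogeneous A (map d [i..<j]) (map x [i..<j])" if "1 \<le> i" "j \<le> k + 1" for i j
    using assms(5) that by (auto simp: homogeneous_def list_all2_conv_all_nth)
  have split: "map x [1..<k + 1] = map x [1..<l] @ x l # map x [l + 1..<k + 1]"
    using assms(3,4) upt_add_eq_append[of 1 l "k + 1 - l"] upt_conv_Cons[of l "k + 1"]
    by (simp del: upt_Suc)
  have "{1..l - 1} = {1..<l}" "{l + 1..k} = {l + 1..<k + 1}"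
    using assms(3) by auto
  then have sums: "sum_list (map d [1..<l]) = (\<Sum>t = 1..l - 1. d t)"
    "sum_list (map d [l + 1..<k + 1]) = (\<Sum>t = l + 1..k. d t)"
    by (simp_all only: interv_sum_list_conv_sum_set_nat set_upt)
  have "x l \<in> A (d l)" using assms(3-5) by simp
  \<comment> \<open>The prefix before \<open>x l\<close> has \<open>l - 1\<close> entries, so
    \<open>int (length us) + 1\<close> becomes \<open>int l\<close>.\<close>
  from fundamental_class_rotate[OF assms(2) hom[of 1 l] this hom[of "l + 1" "k + 1"] assms(6), of k] assms(3,4)
  show ?thesis
    unfolding duality_map_def split sums by simp
qed

end
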